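(* There exist an $\mathcal L_0$-structure $\mathcal A$, with underlying set $A$, which is a model of $\mathrm{PA}_{\mathrm{smu}}^{-}\cup\operatorname{Th}_{\forall}(\mathfrak N_0)$, and an element $d\in A$ such that, for every $a\in A$ and every $j\in\{0,1,2\}$, $$d\ne 3a+j$$ (where $3$, $j$, $+$ and multiplication are interpreted in $\mathcal A$).
   Context: The base language is $\mathcal L_0=\{0,1,+,\cdot,\le\}$ (first-order logic with equality). Abbreviations: $2:=1+1$; $3:=2+1$; $x<y$ means $x\le y\land x\ne y$; $x\mid y$ means $\exists z\,(z\cdot x=y)$; $\operatorname{pow}_2(x)$ means $\forall y\,(y\mid x\rightarrow(y=1\lor 2\mid y))$. $\mathrm{PA}_{\mathrm{smu}}^{-}$ is the $\mathcal L_0$-theory whose axioms are the universal closures of: (pa1) $x+0=x$; (pa2) $x+y=y+x$; (pa3) $(x+y)+z=x+(y+z)$; (pa4) $x\cdot1=x$; (pa5) $x\cdot y=y\cdot x$; (pa6) $(x\cdot y)\cdot z=x\cdot(y\cdot z)$; (pa7) $x\cdot(y+z)=x\cdot y+x\cdot z$; (pa8) $x\le y\lor y\le x$; (pa9) $(x\le y\land y\le z)\rightarrow x\le z$; (pa10) $\neg(x+1\le x)$; (pa11) $y\le x\rightarrow(y=x\lor y+1\le x)$; (pa12) $y\le x\rightarrow y+z\le x+z$; (pa13) $y\le x\rightarrow y\cdot z\le x\cdot z$; (pa15) $y\le x\rightarrow\exists z\,(x=y+z)$; (pa19) $\exists u\,(\operatorname{pow}_2(u)\land u\le x+1\land x+1<2\cdot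 u)$; (pa20) $(\operatorname{pow}_2(x)\land\operatorname{pow}_2(y)\land x\le y)\rightarrow x\mid y$. $\mathfrak N_0=(\mathbb N;0,1,+,\cdot,\le)$ is the standard model ($0\in\mathbb N$). $\operatorname{Th}_{\forall}(\mathfrak N_0)$ is the set of all universal $\mathcal L_0$-sentences (a block of universal quantifiers followed by a quantifier-free formula) true in $\mathfrak N_0$. *)

theory Defs imports Main begin

datatype tm =
    Var nat
  | Zero
  | One
  | Add tm tm (infixl "\<oplus>" 65)
  | Mul tm tm (infixl "\<odot>" 70)

datatype fm =
    Eq tm tm (infix "\<doteq>" 50)
  | Le tm tm (infix "\<preceq>" 50)
  | Neg fm ("\<^bold>\<not> _" [40] 40)
  | And fm fm (infixr "\<^bold>\<and>" 35)
  | Or fm fm (infixr "\<^bold>\<or>" 30)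
  | Imp fm fm (infixr "\<^bold>\<longrightarrow>" 25)
  | Forall nat fm
  | Exists nat fm

primrec tvars :: "tm \<Rightarrow> nat set" where
  "tvars (Var x) = {x}"
| "tvars Zero = {}"
| "tvars One = {}"
| "tvars (s \<oplus> t) = tvars s \<union> tvars t"
| "tvars (s \<odot> t) = tvars s \<union> tvars t"

primrec fv :: "fm \<Rightarrow> nat set" where
  "fv (s \<doteq> t) = tvars s \<union> tvars t"
| "fv (s \<preceq> t) = tvars s \<union> tvars t"
| "fv (\<^bold>\<not> p) = fv p"
| "fv (p \<^bold>\<and> q) = fv p \<union> fv q"
| "fv (p \<^bold>\<or> q) = fv p \<union> fv q"
| "fv (p \<^bold>\<longrightarrow> q) = fv p \<union> fv q"
| "fv (Forall x p) = fv p - {x}"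
| "fv (Exists x p) = fv p - {x}"

definition sentence :: "fm \<Rightarrow> bool" where
  "sentence p \<longleftrightarrow> fv p = {}"

primrec quantifier_free :: "fm \<Rightarrow> bool" where
  "quantifier_free (s \<doteq> t) \<longleftrightarrow> True"
| "quantifier_free (s \<preceq> t) \<longleftrightarrow> True"
| "quantifier_free (\<^bold>\<not> p) \<longleftrightarrow> quantifier_free p"
| "quantifier_free (p \<^bold>\<and> q) \<longleftrightarrow> quantifier_free p \<and> quantifier_free q"
| "quantifier_free (p \<^bold>\<or> q) \<longleftrightarrow> quantifier_free p \<and> quantifier_free q"
| "quantifier_free (p \<^bold>\<longrightarrow> q) \<longleftrightarrow> quantifier_free p \<and> quantifier_free q"
| "quantifier_free (Forall x p) \<longleftrightarrow> False"
| "quantifier_free (Exists x p) \<longleftrightarrow> False"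

definition alls :: "nat list \<Rightarrow> fm \<Rightarrow> fm" where
  "alls xs p = foldr Forall xs p"

definition univ_closure :: "fm \<Rightarrow> fm" where
  "univ_closure p = alls (sorted_list_of_set (fv p)) p"

definition universal_sentence :: "fm \<Rightarrow> bool" where
  "universal_sentence p \<longleftrightarrow> sentence p \<and> (\<exists>xs q. quantifier_free q \<and> p = alls xs q)"

record 'a struct =
  universe :: "'a set"
  zero_in :: 'a
  one_in :: 'a
  add_in :: "'a \<Rightarrow> 'a \<Rightarrow> 'a"
  mul_in :: "'a \<Rightarrow> 'a \<Rightarrow> 'a"
  le_in :: "'a \<Rightarrow> 'a \<Rightarrow> bool"

text \<open>The operations are total on the type \<open>'a\<close>; only their restrictions to the underlying set
  \<open>universe A\<close> matter. Nonemptiness of \<open>universe A\<close> follows from the first conjunct.\<close>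

definition is_structure :: "'a struct \<Rightarrow> bool" where
  "is_structure A \<longleftrightarrow> zero_in A \<in> universe A \<and> one_in A \<in> universe A \<and>
     (\<forall>a\<in>universe A. \<forall>b\<in>universe A. add_in A a b \<in> universe A \<and> mul_in A a b \<in> universe A)"

primrec eval_tm :: "'a struct \<Rightarrow> (nat \<Rightarrow> 'a) \<Rightarrow> tm \<Rightarrow> 'a" where
  "eval_tm A e (Var x) = e x"
| "eval_tm A e Zero = zero_in A"
| "eval_tm A e One = one_in A"
| "eval_tm A e (s \<oplus> t) = add_in A (eval_tm A e s) (eval_tm A e t)"
| "eval_tm A e (s \<odot> t) = mul_in A (eval_tm A e s) (eval_tm A e t)"

primrec sat :: "'a struct \<Rightarrow> (nat \<Rightarrow> 'a) \<Rightarrow> fm \<Rightarrow> bool" where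
  "sat A e (s \<doteq> t) \<longleftrightarrow> eval_tm A e s = eval_tm A e t"
| "sat A e (s \<preceq> t) \<longleftrightarrow> le_in A (eval_tm A e s) (eval_tm A e t)"
| "sat A e (\<^bold>\<not> p) \<longleftrightarrow> \<not> sat A e p"
| "sat A e (p \<^bold>\<and> q) \<longleftrightarrow> sat A e p \<and> sat A e q"
| "sat A e (p \<^bold>\<or> q) \<longleftrightarrow> sat A e p \<or> sat A e q"
| "sat A e (p \<^bold>\<longrightarrow> q) \<longleftrightarrow> (sat A e p \<longrightarrow> sat A e q)"
| "sat A e (Forall x p) \<longleftrightarrow> (\<forall>a\<in>universe A. sat A (e(x := a)) p)"
| "sat A e (Exists x p) \<longleftrightarrow> (\<exists>a\<in>universe A. sat A (e(x := a)) p)"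

definition true_in :: "'a struct \<Rightarrow> fm \<Rightarrow> bool" where
  "true_in A p \<longleftrightarrow> (\<forall>e. range e \<subseteq> universe A \<longrightarrow> sat A e p)"

definition is_model :: "'a struct \<Rightarrow> fm set \<Rightarrow> bool" where
  "is_model A T \<longleftrightarrow> is_structure A \<and> (\<forall>p\<in>T. true_in A p)"

definition std_model :: "nat struct" where
  "std_model = \<lparr>universe = UNIV, zero_in = 0, one_in = 1, add_in = (+), mul_in = (*), le_in = (\<le>)\<rparr>"

definition Th_univ :: "'a struct \<Rightarrow> fm set" where
  "Th_univ A = {p. universal_sentence p \<and> true_in A p}"

abbreviation Two :: tm where "Two \<equiv> One \<oplus> One"

definition Less :: "tm \<Rightarrow> tm \<Rightarrow> fm" (infix "\<prec>" 50) where
  "s \<prec> t = (s \<preceq> t \<^bold>\<and> \<^bold>\<not> (s \<doteq> t))"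

text \<open>To avoid variable capture, the variables 4 and 5 are reserved as bound variables:
  \<open>Divides s t\<close> is meant for terms not containing variable 5, and \<open>Pow2 s\<close> for terms containing
  neither variable 4 nor variable 5.\<close>

definition Divides :: "tm \<Rightarrow> tm \<Rightarrow> fm" where
  "Divides s t = Exists 5 (Var 5 \<odot> s \<doteq> t)"

definition Pow2 :: "tm \<Rightarrow> fm" where
  "Pow2 s = Forall 4 (Divides (Var 4) s \<^bold>\<longrightarrow> (Var 4 \<doteq> One \<^bold>\<or> Divides Two (Var 4)))"

abbreviation "vx \<equiv> Var 0"
abbreviation "vy \<equiv> Var 1"
abbreviation "vz \<equiv> Var 2"
abbreviation "vu \<equiv> Var 3"

definition PA_smu :: "fm set" where
  "PA_smu = univ_closure ` {
     vx \<oplus> Zero \<doteq> vx,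
     vx \<oplus> vy \<doteq> vy \<oplus> vx,
     (vx \<oplus> vy) \<oplus> vz \<doteq> vx \<oplus> (vy \<oplus> vz),
     vx \<odot> One \<doteq> vx,
     vx \<odot> vy \<doteq> vy \<odot> vx,
     (vx \<odot> vy) \<odot> vz \<doteq> vx \<odot> (vy \<odot> vz),
     vx \<odot> (vy \<oplus> vz) \<doteq> vx \<odot> vy \<oplus> vx \<odot> vz,
     vx \<preceq> vy \<^bold>\<or> vy \<preceq> vx,
     (vx \<preceq> vy \<^bold>\<and> vy \<preceq> vz) \<^bold>\<longrightarrow> vx \<preceq> vz,
     \<^bold>\<not> (vx \<oplus> One \<preceq> vx),
     vy \<preceq> vx \<^bold>\<longrightarrow> (vy \<doteq> vx \<^bold>\<or> vy \<oplus> One \<preceq> vx),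
     vy \<preceq> vx \<^bold>\<longrightarrow> vy \<oplus> vz \<preceq> vx \<oplus> vz,
     vy \<preceq> vx \<^bold>\<longrightarrow> vy \<odot> vz \<preceq> vx \<odot> vz,
     vy \<preceq> vx \<^bold>\<longrightarrow> Exists 2 (vx \<doteq> vy \<oplus> vz),
     Exists 3 (Pow2 vu \<^bold>\<and> vu \<preceq> vx \<oplus> One \<^bold>\<and> vx \<oplus> One \<prec> Two \<odot> vu),
     (Pow2 vx \<^bold>\<and> Pow2 vy \<^bold>\<and> vx \<preceq> vy) \<^bold>\<longrightarrow> Divides vx vy }"

lemma finite_tvars: "finite (tvars t)"
  by (induction t) auto

lemma finite_fv: "finite (fv p)"
  by (induction p) (auto simp: finite_tvars)

lemma fv_alls: "fv (alls xs p) = fv p - set xs"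
  by (induction xs) (auto simp: alls_def)

lemma sentence_univ_closure: "sentence (univ_closure p)"
  by (simp add: sentence_def univ_closure_def fv_alls finite_fv)

lemma eval_tm_cong: "(\<And>x. x \<in> tvars t \<Longrightarrow> e x = e' x) \<Longrightarrow> eval_tm A e t = eval_tm A e' t"
  by (induction t) auto

lemma eval_tm_upd: "x \<notin> tvars t \<Longrightarrow> eval_tm A (e(x := a)) t = eval_tm A e t"
  by (rule eval_tm_cong) auto

lemma true_in_Forall: "true_in A (Forall x p) \<longleftrightarrow> true_in A p"
proof
  assume h: "true_in A (Forall x p)"
  show "true_in A p" unfolding true_in_def
  proof (intro allI impI)
    fix e :: "nat \<Rightarrow> 'a" assume e: "range e \<subseteq> universe A"
    then have "sat A e (Forall x p)" using h unfolding true_in_def by blast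
    moreover have "e x \<in> universe A" using e by blast
    ultimately have "sat A (e(x := e x)) p" unfolding sat.simps by (rule bspec)
    then show "sat A e p" by simp
  qed
next
  assume h: "true_in A p"
  show "true_in A (Forall x p)" unfolding true_in_def
  proof (intro allI impI)
    fix e :: "nat \<Rightarrow> 'a" assume e: "range e \<subseteq> universe A"
    have "sat A (e(x := a)) p" if "a \<in> universe A" for a
    proof -
      have "range (e(x := a)) \<subseteq> universe A" using e that by (auto simp: fun_upd_def)
      then show ?thesis using h unfolding true_in_def by blast
    qed
    then show "sat A e (Forall x p)" by simp
  qed
qed

lemma true_in_alls: "true_in A (alls xs p) \<longleftrightarrow> true_in A p"
  by (induction xs) (auto simp: alls_def true_in_Forall)

lemma true_in_univ_closure: "true_in A (univ_closure p) \<longleftrightarrow> true_in A p"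
  by (simp add: univ_closure_def true_in_alls)

lemma sat_Divides:
  assumes "5 \<notin> tvars s \<union> tvars t"
  shows "sat A e (Divides s t) \<longleftrightarrow> (\<exists>c\<in>universe A. mul_in A c (eval_tm A e s) = eval_tm A e t)"
proof -
  have "eval_tm A (e(5 := c)) s = eval_tm A e s" "eval_tm A (e(5 := c)) t = eval_tm A e t" for c
    using assms by (simp_all add: eval_tm_upd)
  then show ?thesis by (simp add: Divides_def)
qed

lemma sat_Pow2:
  assumes "4 \<notin> tvars s" "5 \<notin> tvars s"
  shows "sat A e (Pow2 s) \<longleftrightarrow>
    (\<forall>b\<in>universe A. (\<exists>c\<in>universe A. mul_in A c b = eval_tm A e s) \<longrightarrow>
       b = one_in A \<or> (\<exists>c\<in>universe A. mul_in A c (add_in A (one_in A) (one_in A)) = b))"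
proof -
  have "eval_tm A (e(4 := b)) s = eval_tm A e s" for b
    using assms by (simp_all add: eval_tm_upd)
  then show ?thesis using assms by (simp add: Pow2_def sat_Divides)
qed

end

theory Submission
  imports Defs "HOL-Computational_Algebra.Polynomial" "HOL-Library.Countable"
begin

text \<open>Let \<open>R\<close> be the ring of polynomials over \<open>\<int>[1/2]\<close> with integer constant term, ordered so that
  \<open>X\<close> is infinitely large; the model is its nonnegative part. Substituting \<open>X = 2 ^ t\<close> sends any
  given element of the model to a natural number once \<open>t\<close> is large, and for \<open>t\<close> large it also
  respects any given finite list of equations and inequalities. So a counterexample to a universal
  sentence in the model yields one in \<open>\<nat>\<close>. The powers of two of the model are exactly
  the monomials \<open>2 ^ i * X ^ m\<close> that lie in it (\<open>i\<close> may be negative if \<open>m > 0\<close>); there is one in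
  every required interval, and they are ordered by divisibility. Since 3 is not invertible in
  \<open>\<int>[1/2]\<close>, no \<open>X - j\<close> is a multiple of 3.\<close>

section \<open>Isomorphic copies of structures\<close>

definition image_struct :: "('a \<Rightarrow> 'b) \<Rightarrow> 'a struct \<Rightarrow> 'b struct" where
  "image_struct f A = (let g = inv_into (universe A) f in
     \<lparr>universe = f ` universe A, zero_in = f (zero_in A), one_in = f (one_in A),
      add_in = (\<lambda>x y. f (add_in A (g x) (g y))), mul_in = (\<lambda>x y. f (mul_in A (g x) (g y))),
      le_in = (\<lambda>x y. le_in A (g x) (g y))\<rparr>)"

lemma universe_image_struct [simp]: "universe (image_struct f A) = f ` universe A"
  and zero_in_image_struct [simp]: "zero_in (image_struct f A) = f (zero_in A)"
  and one_in_image_struct [simp]: "one_in (image_struct f A) = f (one_in A)"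
  by (simp_all add: image_struct_def Let_def)

lemma image_struct_ops:
  assumes "inj_on f (universe A)" "a \<in> universe A" "b \<in> universe A"
  shows "add_in (image_struct f A) (f a) (f b) = f (add_in A a b)"
    and "mul_in (image_struct f A) (f a) (f b) = f (mul_in A a b)"
    and "le_in (image_struct f A) (f a) (f b) \<longleftrightarrow> le_in A a b"
  using assms by (simp_all add: image_struct_def Let_def)

lemma eval_tm_in_universe:
  assumes "is_structure A" "range e \<subseteq> universe A"
  shows "eval_tm A e t \<in> universe A"
  using assms by (induction t) (auto simp: is_structure_def)

lemma eval_tm_image_struct:
  assumes "is_structure A" "inj_on f (universe A)" "range e \<subseteq> universe A"
  shows "eval_tm (image_struct f A) (f \<circ> e) t = f (eval_tm A e t)"
  using assms by (induction t) (simp_all add: image_struct_ops eval_tm_in_universe)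

lemma sat_image_struct:
  assumes "is_structure A" "inj_on f (universe A)" "range e \<subseteq> universe A"
  shows "sat (image_struct f A) (f \<circ> e) p \<longleftrightarrow> sat A e p"
  using assms(3)
proof (induction p arbitrary: e)
  case (Eq s t)
  then show ?case
    unfolding sat.simps eval_tm_image_struct[OF assms(1,2) Eq]
    using assms Eq by (simp add: eval_tm_in_universe inj_on_eq_iff)
next
  case (Le s t)
  then show ?case
    unfolding sat.simps eval_tm_image_struct[OF assms(1,2) Le]
    using assms Le by (simp add: eval_tm_in_universe image_struct_ops)
next
  case (Forall x p)
  have "sat (image_struct f A) ((f \<circ> e)(x := f a)) p \<longleftrightarrow> sat A (e(x := a)) p"
    if "a \<in> universe A" for a
  proof -
    have "range (e(x := a)) \<subseteq> universe A" using Forall.prems that by auto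
    from Forall.IH[OF this] show ?thesis by (simp only: fun_upd_comp)
  qed
  then show ?case unfolding sat.simps universe_image_struct by blast
next
  case (Exists x p)
  have "sat (image_struct f A) ((f \<circ> e)(x := f a)) p \<longleftrightarrow> sat A (e(x := a)) p"
    if "a \<in> universe A" for a
  proof -
    have "range (e(x := a)) \<subseteq> universe A" using Exists.prems that by auto
    from Exists.IH[OF this] show ?thesis by (simp only: fun_upd_comp)
  qed
  then show ?case unfolding sat.simps universe_image_struct by blast
qed auto

lemma is_model_image_struct:
  assumes "is_model A T" "inj_on f (universe A)"
  shows "is_model (image_struct f A) T"
proof -
  have A: "is_structure A" using assms by (simp add: is_model_def)
  have "true_in (image_struct f A) p" if "p \<in> T" for p
    unfolding true_in_def
  proof (intro allI impI)
    fix e :: "nat \<Rightarrow> 'b" assume e: "range e \<subseteq> universe (image_struct f A)"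
    \<comment> \<open>Every valuation in the copy is the \<open>f\<close>-image of one in
      \<open>A\<close>, so \<open>sat_image_struct\<close> covers all of them.\<close>
    define e' where "e' = inv_into (universe A) f \<circ> e"
    have e': "range e' \<subseteq> universe A" using e by (auto simp: e'_def intro!: inv_into_into)
    have "f \<circ> e' = e"
    proof
      fix i
      have "e i \<in> f ` universe A" using e by auto
      then show "(f \<circ> e') i = e i" by (simp add: e'_def f_inv_into_f)
    qed
    moreover have "sat A e' p" using assms e' that by (auto simp: is_model_def true_in_def)
    ultimately show "sat (image_struct f A) e p"
      using sat_image_struct[OF A assms(2) e'] by metis
  qed
  moreover have "is_structure (image_struct f A)"
    using A assms(2) by (auto simp: is_structure_def image_struct_ops)
  ultimately show ?thesis by (simp add: is_model_def)
qed

section \<open>Dyadic rationals\<close>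

text \<open>Membership in the ring of integers with 2 inverted, that is, in Z[1/2].\<close>

definition dyadic :: "rat \<Rightarrow> bool" where
  "dyadic c \<longleftrightarrow> (\<exists>k. 2 ^ k * c \<in> \<int>)"

lemma dyadic_Ints: "c \<in> \<int> \<Longrightarrow> dyadic c"
  unfolding dyadic_def by (rule exI[of _ 0]) simp

lemma dyadic_mult: "dyadic a \<Longrightarrow> dyadic b \<Longrightarrow> dyadic (a * b)"
proof -
  assume "dyadic a" "dyadic b"
  then obtain k l where "2 ^ k * a \<in> \<int>" "2 ^ l * b \<in> \<int>" by (auto simp: dyadic_def)
  then have "(2 ^ k * a) * (2 ^ l * b) \<in> \<int>" by (rule Ints_mult)
  then have "2 ^ (k + l) * (a * b) \<in> \<int>" by (simp add: power_add mult_ac)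
  then show ?thesis by (auto simp: dyadic_def)
qed

lemma dyadic_add: "dyadic a \<Longrightarrow> dyadic b \<Longrightarrow> dyadic (a + b)"
proof -
  assume "dyadic a" "dyadic b"
  then obtain k l where "2 ^ k * a \<in> \<int>" "2 ^ l * b \<in> \<int>" by (auto simp: dyadic_def)
  then have "2 ^ l * (2 ^ k * a) + 2 ^ k * (2 ^ l * b) \<in> \<int>"
    by (metis Ints_add Ints_mult Ints_power Ints_numeral)
  then have "2 ^ (k + l) * (a + b) \<in> \<int>" by (simp add: power_add algebra_simps)
  then show ?thesis by (auto simp: dyadic_def)
qed

lemma dyadic_uminus: "dyadic a \<Longrightarrow> dyadic (- a)"
  by (auto simp: dyadic_def)

lemma dyadic_diff: "dyadic a \<Longrightarrow> dyadic b \<Longrightarrow> dyadic (a - b)"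
  using dyadic_add[of a "- b"] dyadic_uminus by simp

lemma dyadic_sum: "(\<And>i. i \<in> S \<Longrightarrow> dyadic (f i)) \<Longrightarrow> dyadic (sum f S)"
  by (induction S rule: infinite_finite_induct) (auto intro: dyadic_add dyadic_Ints)

lemma dyadic_two_powi: "dyadic (2 powi i)"
proof (cases "i \<ge> 0")
  case True
  then show ?thesis by (auto intro!: dyadic_Ints simp: power_int_def)
next
  case False
  then have "2 ^ nat (- i) * (2 powi i :: rat) \<in> \<int>"
    by (simp add: power_int_def power_inverse flip: power_mult_distrib)
  then show ?thesis unfolding dyadic_def ..
qed

lemma dyadic_decompose:
  assumes "dyadic c" "c \<noteq> 0"
  obtains i w where "c = 2 powi i * of_int w" "odd w"
proof -
  obtain k n where n: "2 ^ k * c = of_int n" using assms by (auto simp: dyadic_def Ints_def)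
  then have "n \<noteq> 0" using assms by auto
  moreover have "\<not> is_unit (2 :: int)" by simp
  ultimately obtain w where w: "n = 2 ^ multiplicity 2 n * w" "odd w"
    using multiplicity_decompose'[of n 2] by metis
  have "c = of_int n / 2 ^ k" using n by (simp add: field_simps)
  also have "\<dots> = 2 powi (int (multiplicity 2 n) - int k) * of_int w"
    by (subst w(1)) (simp add: power_int_diff)
  finally show ?thesis using that w(2) by blast
qed

text \<open>If \<open>i\<close> were negative, clearing the denominator would make \<open>w\<close>
  even.\<close>

lemma two_powi_odd_Ints:
  assumes "2 powi i * of_int w \<in> (\<int> :: rat set)" "odd w"
  shows "i \<ge> 0"
proof (rule ccontr)
  assume i: "\<not> i \<ge> 0"
  obtain n where n: "2 powi i * of_int w = (of_int n :: rat)" using assms by (auto simp: Ints_def)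
  have "(of_int w :: rat) = 2 ^ nat (- i) * (2 powi i * of_int w)"
    using i by (simp add: power_int_def power_inverse flip: power_mult_distrib)
  also have "\<dots> = of_int (2 ^ nat (- i) * n)" using n by simp
  finally have "w = 2 ^ nat (- i) * n" by (simp only: of_int_eq_iff)
  then show False using assms(2) i by simp
qed

text \<open>The only units of Z[1/2] are powers of 2 up to sign: after clearing denominators
  \<open>w\<close> divides a power of 2 among the integers, and an odd \<open>w\<close> is coprime
  to it. The case \<open>w = 3\<close>, \<open>i = 0\<close> says that 3 has no inverse.\<close>

lemma odd_dyadic_divisor_two_powi:
  assumes "of_int w * c = (2 powi i :: rat)" "dyadic c" "odd w"
  shows "\<bar>w\<bar> = 1"
proof -
  obtain k n where n: "2 ^ k * c = of_int n" using assms by (auto simp: dyadic_def Ints_def)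
  have "(of_int (w * n * 2 ^ nat (- i)) :: rat) = 2 ^ k * 2 ^ nat (- i) * (of_int w * c)"
    using n by (simp add: algebra_simps)
  also have "\<dots> = 2 ^ k * (2 ^ nat (- i) * 2 powi i)" by (simp add: assms(1))
  \<comment> \<open>This covers both signs, because \<open>nat\<close> sends negative integers to
    0.\<close>
  also have "2 ^ nat (- i) * 2 powi i = (2 ^ nat i :: rat)"
    by (cases "i \<ge> 0") (simp_all add: power_int_def power_inverse flip: power_mult_distrib)
  also have "2 ^ k * 2 ^ nat i = (of_int (2 ^ (k + nat i)) :: rat)" by (simp add: power_add)
  finally have "w * n * 2 ^ nat (- i) = 2 ^ (k + nat i)" by (simp only: of_int_eq_iff)
  then have "w dvd 2 ^ (k + nat i)" by (metis dvd_mult2 dvd_triv_left)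
  moreover have "coprime w (2 ^ (k + nat i))"
    using assms(3) by simp
  ultimately have "is_unit w" by (metis coprime_absorb_left)
  then show ?thesis by simp
qed

text \<open>The integer numerator lies between two consecutive powers of 2; dividing by
  \<open>2 ^ k\<close> shifts the exponents.\<close>

lemma dyadic_between_two_powi:
  assumes "dyadic c" "c > 0"
  obtains i where "2 powi i \<le> c" "c < 2 powi (i + 1)"
proof -
  obtain k n where n: "2 ^ k * c = of_int n" using assms by (auto simp: dyadic_def Ints_def)
  then have "(of_int n :: rat) > 0"
    using assms by (metis zero_less_mult_iff zero_less_numeral zero_less_power)
  then have "nat n \<ge> 1" by simp
  then obtain r where r: "2 ^ r \<le> nat n" "nat n < 2 ^ (r + 1)"
    using ex_power_ivl1[of 2 "nat n"] by auto
  have "n \<ge> 1" using \<open>nat n \<ge> 1\<close> by linarith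
  have "2 ^ r \<le> int (nat n)" "int (nat n) < 2 ^ (r + 1)"
    using r by (metis of_nat_le_iff of_nat_numeral of_nat_power,
        metis of_nat_less_iff of_nat_numeral of_nat_power)
  then have "2 ^ r \<le> n" "n < 2 ^ (r + 1)" using \<open>n \<ge> 1\<close> by simp_all
  then have "of_int (2 ^ r) \<le> (of_int n :: rat)" "(of_int n :: rat) < of_int (2 ^ (r + 1))"
    by (simp_all only: of_int_le_iff of_int_less_iff)
  then have "2 powi (int r - int k) \<le> c" "c < 2 powi (int r - int k + 1)"
    by (simp_all add: n[symmetric] power_int_diff power_int_add field_simps)
  then show ?thesis using that by blast
qed

section \<open>Polynomials ordered by their leading coefficient\<close>

text \<open>Here \<open>n\<close> only bounds the degrees, so that polynomials of different degrees
  can be compared by padding with zero coefficients.\<close>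

lemma poly_less_lead:
  fixes p q :: "'a :: linordered_idom poly"
  assumes "degree p \<le> n" "degree q \<le> n" "coeff p n < coeff q n"
  shows "p < q"
proof -
  have "degree (q - p) \<le> n" using assms by (simp add: degree_diff_le)
  moreover have "coeff (q - p) n \<noteq> 0" using assms by simp
  ultimately have "degree (q - p) = n" using le_degree le_antisym by blast
  then show ?thesis using assms by (simp add: less_poly_def pos_poly_def)
qed

lemma poly_pos_iff: "0 < p \<longleftrightarrow> 0 < lead_coeff p" for p :: "'a :: linordered_idom poly"
  by (simp add: less_poly_def pos_poly_def)

lemma monom_mono_iff: "monom a n \<le> monom b n \<longleftrightarrow> a \<le> b" for a b :: "'a :: linordered_idom"
proof -
  have "monom a n < monom b n" if "a < b" for a b :: 'a
    using that by (intro poly_less_lead[of _ n]) (auto simp: degree_monom_le)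
  then show ?thesis by (metis linorder_less_linear linorder_not_less order.refl order.strict_implies_order)
qed

lemma monom_nonneg: "a \<ge> 0 \<Longrightarrow> 0 \<le> monom a n" for a :: "'a :: linordered_idom"
  using monom_mono_iff[of 0 n a] by simp

text \<open>A bound away from 0 makes the induction work where mere positivity would not:
  \<open>x * poly q x\<close> is at least \<open>x * c\<close>, which outgrows any constant term
  \<open>a\<close>.\<close>

lemma poly_eventually_ge:
  fixes p :: "'a :: linordered_field poly"
  assumes "p > 0"
  shows "\<exists>c>0. \<exists>B. \<forall>x\<ge>B. c \<le> poly p x"
  using assms
proof (induction p)
  case (pCons a q)
  show ?case
  proof (cases "q = 0")
    case True
    then show ?thesis using pCons.prems by (auto simp: poly_pos_iff)
  next
    case False
    then have "q > 0" using pCons.prems by (simp add: poly_pos_iff)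
    then obtain c B where c: "c > 0" "\<And>x. x \<ge> B \<Longrightarrow> c \<le> poly q x" using pCons.IH by auto
    have "1 \<le> poly (pCons a q) x" if "x \<ge> max B (max 0 ((1 - a) / c))" for x
    proof -
      have "1 - a \<le> x * c" using that c by (simp add: field_simps)
      also have "\<dots> \<le> x * poly q x" using that c by (simp add: mult_left_mono)
      finally show ?thesis by simp
    qed
    then show ?thesis by (metis zero_less_one)
  qed
qed simp

text \<open>\<open>X\<close> is prime, so it divides \<open>p\<close> or \<open>q\<close>, and
  cancelling it lowers \<open>n\<close>; for \<open>n = 0\<close> the degrees force both factors to
  be constant.\<close>

lemma monom_factor:
  fixes p q :: "'a :: idom poly"
  assumes "p * q = monom c n" "c \<noteq> 0"
  shows "\<exists>a k. p = monom a k"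
  using assms
proof (induction n arbitrary: p q)
  case 0
  then have "p * q \<noteq> 0" by simp
  then have "degree p + degree q = 0" using 0 by (metis degree_monom_eq degree_mult_eq mult_eq_0_iff)
  then show ?case by (metis add_is_0 degree_eq_zeroE monom_0)
next
  case (Suc n)
  have "coeff p 0 * coeff q 0 = 0"
    using Suc.prems by (metis coeff_mult_0 coeff_monom nat.distinct(1))
  then consider "coeff p 0 = 0" | "coeff q 0 = 0" by auto
  then show ?case
  proof cases
    case 1
    then obtain p' where p: "p = pCons 0 p'" by (cases p) auto
    then have "p' * q = monom c n" using Suc.prems by (simp add: monom_Suc)
    then show ?thesis using Suc.IH Suc.prems p by (metis monom_Suc)
  next
    case 2
    then obtain q' where q: "q = pCons 0 q'" by (cases q) auto
    then have "p * q' = monom c n" using Suc.prems by (simp add: monom_Suc)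
    then show ?thesis using Suc.IH Suc.prems by metis
  qed
qed

section \<open>The model\<close>

text \<open>The integral constant term keeps 1 the least positive element. The denominators at
  higher degrees supply missing powers of two: below \<open>X - 1\<close>, for instance, the largest
  one is \<open>X / 2\<close>.\<close>

definition dyadic_polys :: "rat poly set" where
  "dyadic_polys = {p. coeff p 0 \<in> \<int> \<and> (\<forall>i. dyadic (coeff p i))}"

lemma dyadic_polys_of_int: "of_int n \<in> dyadic_polys"
  by (auto simp: dyadic_polys_def of_int_poly coeff_pCons split: nat.split intro!: dyadic_Ints)

lemma dyadic_polys_numerals: "0 \<in> dyadic_polys" "1 \<in> dyadic_polys" "numeral n \<in> dyadic_polys"
  using dyadic_polys_of_int[of 0] dyadic_polys_of_int[of 1] dyadic_polys_of_int[of "numeral n"]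
  by simp_all

lemma dyadic_polys_add: "p \<in> dyadic_polys \<Longrightarrow> q \<in> dyadic_polys \<Longrightarrow> p + q \<in> dyadic_polys"
  by (auto simp: dyadic_polys_def intro: dyadic_add)

lemma dyadic_polys_diff: "p \<in> dyadic_polys \<Longrightarrow> q \<in> dyadic_polys \<Longrightarrow> p - q \<in> dyadic_polys"
  by (auto simp: dyadic_polys_def intro: dyadic_diff)

lemma dyadic_polys_mult: "p \<in> dyadic_polys \<Longrightarrow> q \<in> dyadic_polys \<Longrightarrow> p * q \<in> dyadic_polys"
  by (auto simp: dyadic_polys_def coeff_mult intro: dyadic_sum dyadic_mult)

lemma monom_in_dyadic_polys:
  assumes "dyadic c" "m = 0 \<Longrightarrow> c \<in> \<int>"
  shows "monom c m \<in> dyadic_polys"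
  using assms by (auto simp: dyadic_polys_def intro: dyadic_Ints)

text \<open>Constant elements are integers, and positive elements of higher degree are infinitely
  large.\<close>

lemma dyadic_polys_ge_1:
  assumes "p \<in> dyadic_polys" "p > 0"
  shows "p \<ge> 1"
proof (cases "degree p = 0")
  case True
  then obtain c where p: "p = [:c:]" by (rule degree_eq_zeroE)
  then obtain n where n: "c = of_int n" using assms by (auto simp: dyadic_polys_def Ints_def)
  then have "n > 0" using assms p by (simp add: poly_pos_iff)
  then have "c \<ge> 1" using n by simp
  then show ?thesis using monom_mono_iff[of 1 0 c] p by (simp add: monom_0 one_pCons)
next
  case False
  then have "1 < p"
    using assms by (intro poly_less_lead[of _ "degree p"]) (auto simp: coeff_1 poly_pos_iff)
  then show ?thesis by simp
qed

definition poly_model :: "rat poly struct" where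
  "poly_model = \<lparr>universe = {p \<in> dyadic_polys. 0 \<le> p}, zero_in = 0, one_in = 1,
     add_in = (+), mul_in = (*), le_in = (\<le>)\<rparr>"

lemma poly_model_simps [simp]:
  "p \<in> universe poly_model \<longleftrightarrow> p \<in> dyadic_polys \<and> 0 \<le> p"
  "zero_in poly_model = 0" "one_in poly_model = 1"
  "add_in poly_model = (+)" "mul_in poly_model = (*)" "le_in poly_model = (\<le>)"
  by (simp_all add: poly_model_def)

lemma is_structure_poly_model: "is_structure poly_model"
  by (simp add: is_structure_def dyadic_polys_numerals dyadic_polys_add dyadic_polys_mult)

section \<open>Universal sentences\<close>

text \<open>Substitution of \<open>2 ^ t\<close> for \<open>X\<close>. Floor and \<open>nat\<close>
  only make it total: on an element of the model the value is already a natural number once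
  \<open>t\<close> is large.\<close>

definition eval_pow2 :: "nat \<Rightarrow> rat poly \<Rightarrow> nat" where
  "eval_pow2 t p = nat \<lfloor>poly p (2 ^ t)\<rfloor>"

lemma eventually_poly_pow2_pos:
  fixes p :: "rat poly"
  assumes "p > 0"
  shows "eventually (\<lambda>t. poly p (2 ^ t) > 0) sequentially"
proof -
  obtain c B where c: "c > 0" "\<And>x. x \<ge> B \<Longrightarrow> c \<le> poly p x" using poly_eventually_ge[OF assms] by auto
  obtain N where N: "B \<le> of_nat N" using real_arch_simple by blast
  have "poly p (2 ^ t) > 0" if "t \<ge> N" for t
  proof -
    have "N < 2 ^ t" using that less_exp[of t] by linarith
    then have "B \<le> of_nat (2 ^ t)" using N by (meson of_nat_le_iff order.trans less_imp_le)
    then have "c \<le> poly p (2 ^ t)" using c(2)[of "2 ^ t"] by simp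
    then show ?thesis using c(1) by linarith
  qed
  then show ?thesis by (auto simp: eventually_sequentially)
qed

text \<open>At a degree \<open>i > 0\<close> the denominator \<open>2 ^ k\<close> of the coefficient
  is absorbed by \<open>2 ^ (t * i)\<close> as soon as \<open>t \<ge> k\<close>; at degree 0 there
  is no denominator.\<close>

lemma eventually_poly_pow2_Ints:
  assumes "p \<in> dyadic_polys"
  shows "eventually (\<lambda>t. poly p (2 ^ t) \<in> \<int>) sequentially"
proof -
  have "eventually (\<lambda>t. coeff p i * (2 ^ t) ^ i \<in> \<int>) sequentially" for i
  proof (cases "i = 0")
    case True
    then show ?thesis using assms by (simp add: dyadic_polys_def)
  next
    case False
    obtain k where k: "2 ^ k * coeff p i \<in> \<int>" using assms by (auto simp: dyadic_polys_def dyadic_def)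
    have "coeff p i * (2 ^ t) ^ i \<in> \<int>" if "t \<ge> k" for t
    proof -
      have "k \<le> t * i"
        using that False by (metis le_trans mult.commute mult_le_mono nat_mult_1 less_one not_less)
      then have "(2 :: rat) ^ (t * i) = 2 ^ (t * i - k) * 2 ^ k" by (simp flip: power_add)
      then have "coeff p i * (2 ^ t) ^ i = 2 ^ (t * i - k) * (2 ^ k * coeff p i)"
        by (simp only: mult_ac flip: power_mult)
      then show ?thesis using k by (simp only: Ints_mult Ints_power Ints_numeral)
    qed
    then show ?thesis by (auto simp: eventually_sequentially)
  qed
  then have "eventually (\<lambda>t. \<forall>i\<in>{..degree p}. coeff p i * (2 ^ t) ^ i \<in> \<int>) sequentially"
    by (simp add: eventually_ball_finite)
  then show ?thesis
    by eventually_elim (auto simp: poly_altdef intro!: Ints_sum)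
qed

lemma eventually_of_nat_eval_pow2:
  assumes "p \<in> universe poly_model"
  shows "eventually (\<lambda>t. of_nat (eval_pow2 t p) = poly p (2 ^ t)) sequentially"
proof -
  have "eventually (\<lambda>t. poly p (2 ^ t) \<ge> 0) sequentially"
  proof (cases "p = 0")
    case False
    then have "eventually (\<lambda>t. poly p (2 ^ t) > 0) sequentially"
      using assms by (intro eventually_poly_pow2_pos) simp
    then show ?thesis by eventually_elim simp
  qed simp
  moreover have "eventually (\<lambda>t. poly p (2 ^ t) \<in> \<int>) sequentially"
    using assms eventually_poly_pow2_Ints by simp
  ultimately show ?thesis
    by eventually_elim (auto simp: eval_pow2_def elim!: Ints_cases)
qed

text \<open>Evaluation at \<open>2 ^ t\<close> is a ring homomorphism, so \<open>t\<close> has to be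
  large only for the variables that occur in the term.\<close>

lemma eventually_of_nat_eval_tm_eval_pow2:
  assumes "range e \<subseteq> universe poly_model"
  shows "eventually (\<lambda>t. of_nat (eval_tm std_model (eval_pow2 t \<circ> e) s) =
    poly (eval_tm poly_model e s) (2 ^ t)) sequentially"
proof (induction s)
  case (Var x)
  have "e x \<in> universe poly_model" using assms by blast
  then show ?case by (simp add: eventually_of_nat_eval_pow2)
next
  case (Add s t)
  then show ?case by eventually_elim (simp add: std_model_def)
next
  case (Mul s t)
  then show ?case by eventually_elim (simp add: std_model_def)
qed (simp_all add: std_model_def)

text \<open>Atomic formulas must be preserved whether true or false. Trichotomy does this: a failing
  equation or inequality is a strict inequality in the model, and strict inequalities persist for
  large \<open>t\<close>.\<close>

lemma eventually_sat_eval_pow2: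
  assumes e: "range e \<subseteq> universe poly_model" and "quantifier_free p"
  shows "eventually (\<lambda>t. sat std_model (eval_pow2 t \<circ> e) p \<longleftrightarrow> sat poly_model e p) sequentially"
proof -
  have lt: "eventually (\<lambda>t. eval_tm std_model (eval_pow2 t \<circ> e) u < eval_tm std_model (eval_pow2 t \<circ> e) s)
      sequentially"
    if "eval_tm poly_model e u < eval_tm poly_model e s" for s u
  proof -
    have "eventually (\<lambda>t. poly (eval_tm poly_model e s - eval_tm poly_model e u) (2 ^ t) > 0) sequentially"
      using that by (intro eventually_poly_pow2_pos) simp
    with eventually_of_nat_eval_tm_eval_pow2[OF e, of s] eventually_of_nat_eval_tm_eval_pow2[OF e, of u]
    show ?thesis
    proof eventually_elim
      case (elim t)
      then have "(of_nat (eval_tm std_model (eval_pow2 t \<circ> e) u) :: rat)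
          < of_nat (eval_tm std_model (eval_pow2 t \<circ> e) s)" by simp
      then show ?case by (simp only: of_nat_less_iff)
    qed
  qed
  have eq: "eventually (\<lambda>t. eval_tm std_model (eval_pow2 t \<circ> e) u = eval_tm std_model (eval_pow2 t \<circ> e) s)
      sequentially"
    if "eval_tm poly_model e u = eval_tm poly_model e s" for s u
    using eventually_of_nat_eval_tm_eval_pow2[OF e, of s] eventually_of_nat_eval_tm_eval_pow2[OF e, of u]
  proof eventually_elim
    case (elim t)
    then have "(of_nat (eval_tm std_model (eval_pow2 t \<circ> e) u) :: rat)
        = of_nat (eval_tm std_model (eval_pow2 t \<circ> e) s)" using that by simp
    then show ?case by (simp only: of_nat_eq_iff)
  qed
  show ?thesis
    using assms(2)
  proof (induction p)
    case (Eq s u)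
    show ?case
    proof (cases "eval_tm poly_model e s" "eval_tm poly_model e u" rule: linorder_cases)
      case less
      from lt[OF this] show ?thesis by eventually_elim (unfold sat.simps, use less in linarith)
    next
      case equal
      from eq[OF this] show ?thesis by eventually_elim (unfold sat.simps, use equal in linarith)
    next
      case greater
      from lt[OF this] show ?thesis by eventually_elim (unfold sat.simps, use greater in linarith)
    qed
  next
    case (Le s u)
    show ?case
    proof (cases "eval_tm poly_model e s" "eval_tm poly_model e u" rule: linorder_cases)
      case less
      from lt[OF this] show ?thesis by eventually_elim (unfold sat.simps, use less in \<open>simp add: std_model_def\<close>)
    next
      case equal
      from eq[OF this] show ?thesis by eventually_elim (unfold sat.simps, use equal in \<open>simp add: std_model_def\<close>)
    next
      case greater
      from lt[OF this] show ?thesis by eventually_elim (unfold sat.simps, use greater in \<open>simp add: std_model_def\<close>)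
    qed
  next
    case (Neg p)
    then have "eventually (\<lambda>t. sat std_model (eval_pow2 t \<circ> e) p \<longleftrightarrow> sat poly_model e p) sequentially"
      by (simp only: quantifier_free.simps)
    then show ?case by eventually_elim (simp only: sat.simps)
  next
    case (And p q)
    then have "eventually (\<lambda>t. sat std_model (eval_pow2 t \<circ> e) p \<longleftrightarrow> sat poly_model e p) sequentially"
      "eventually (\<lambda>t. sat std_model (eval_pow2 t \<circ> e) q \<longleftrightarrow> sat poly_model e q) sequentially"
      by (simp_all only: quantifier_free.simps)
    then show ?case by eventually_elim (simp only: sat.simps)
  next
    case (Or p q)
    then have "eventually (\<lambda>t. sat std_model (eval_pow2 t \<circ> e) p \<longleftrightarrow> sat poly_model e p) sequentially"
      "eventually (\<lambda>t. sat std_model (eval_pow2 t \<circ> e) q \<longleftrightarrow> sat poly_model e q) sequentially"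
      by (simp_all only: quantifier_free.simps)
    then show ?case by eventually_elim (simp only: sat.simps)
  next
    case (Imp p q)
    then have "eventually (\<lambda>t. sat std_model (eval_pow2 t \<circ> e) p \<longleftrightarrow> sat poly_model e p) sequentially"
      "eventually (\<lambda>t. sat std_model (eval_pow2 t \<circ> e) q \<longleftrightarrow> sat poly_model e q) sequentially"
      by (simp_all only: quantifier_free.simps)
    then show ?case by eventually_elim (simp only: sat.simps)
  qed simp_all
qed

text \<open>A single large \<open>t\<close> suffices for each valuation, because the matrix of a
  true universal sentence holds in the naturals under the substituted valuation.\<close>

lemma poly_model_Th_univ:
  assumes "p \<in> Th_univ std_model"
  shows "true_in poly_model p"
proof -
  obtain xs q where q: "quantifier_free q" "p = alls xs q"
    using assms by (auto simp: Th_univ_def universal_sentence_def)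
  then have std: "true_in std_model q" using assms by (simp add: Th_univ_def true_in_alls)
  have "sat poly_model e q" if e: "range e \<subseteq> universe poly_model" for e
  proof -
    obtain t where "sat std_model (eval_pow2 t \<circ> e) q \<longleftrightarrow> sat poly_model e q"
      using eventually_happens'[OF sequentially_bot eventually_sat_eval_pow2[OF e q(1)]] by auto
    then show ?thesis using std by (simp add: true_in_def std_model_def)
  qed
  then have "true_in poly_model q" by (simp add: true_in_def)
  then show ?thesis by (simp add: q true_in_alls)
qed

section \<open>Powers of two in the model\<close>

text \<open>The meaning of the formula \<open>Pow2\<close> in \<open>poly_model\<close>.\<close>

definition is_pow2 :: "rat poly \<Rightarrow> bool" where
  "is_pow2 p \<longleftrightarrow> (\<forall>b\<in>universe poly_model. (\<exists>c\<in>universe poly_model. c * b = p) \<longrightarrow>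
     b = 1 \<or> (\<exists>c\<in>universe poly_model. c * 2 = b))"

lemma coeff_0_double:
  assumes "c \<in> dyadic_polys"
  obtains n where "coeff (c * 2) 0 = of_int (2 * n)"
proof -
  obtain n where "coeff c 0 = of_int n" using assms by (auto simp: dyadic_polys_def Ints_def)
  then have "coeff (c * 2) 0 = of_int (2 * n)" by (simp add: coeff_mult_0 numeral_poly)
  then show ?thesis by (rule that)
qed

text \<open>A divisor of the monomial is itself a monomial. In positive degree it can always be
  halved; in degree 0 it is a nonnegative integer dividing a power of 2 in Z[1/2], hence 1 or
  even.\<close>

lemma is_pow2_monom:
  assumes "monom (2 powi i) m \<in> dyadic_polys"
  shows "is_pow2 (monom (2 powi i) m)"
  unfolding is_pow2_def
proof (intro ballI impI)
  fix b assume b: "b \<in> universe poly_model" and "\<exists>c\<in>universe poly_model. c * b = monom (2 powi i) m"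
  then obtain c where c: "c \<in> dyadic_polys" "c * b = monom (2 powi i) m" by auto
  have nz: "(2 powi i :: rat) \<noteq> 0" by simp
  obtain \<beta> k where b': "b = monom \<beta> k"
    using monom_factor[of b c] c nz by (metis mult.commute)
  obtain \<gamma> l where c': "c = monom \<gamma> l" using monom_factor[of c b] c nz by metis
  have prod: "\<gamma> * \<beta> = 2 powi i"
    using c(2) nz by (metis b' c' coeff_monom lead_coeff_monom mult_monom)
  have \<beta>: "dyadic \<beta>" "k = 0 \<Longrightarrow> \<beta> \<in> \<int>" "\<beta> \<ge> 0" and \<gamma>: "dyadic \<gamma>"
    using b c(1) monom_mono_iff[of 0 k \<beta>]
    by (auto simp: b' c' dyadic_polys_def split: if_splits)
  show "b = 1 \<or> (\<exists>c\<in>universe poly_model. c * 2 = b)"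
  proof (cases "b = 1")
    case False
    have "k = 0 \<Longrightarrow> \<beta> / 2 \<in> \<int>"
    proof -
      assume k: "k = 0"
      then obtain w where w: "\<beta> = of_int w" using \<beta> by (auto simp: Ints_def)
      \<comment> \<open>The value 1 is excluded by \<open>b \<noteq> 1\<close>, the value -1 by the
        sign of \<open>\<beta>\<close>.\<close>
      have "\<bar>w\<bar> \<noteq> 1" using \<beta>(3) False k by (auto simp: w b')
      then have "even w"
        using odd_dyadic_divisor_two_powi[of w \<gamma> i] prod \<gamma> by (auto simp: w mult.commute)
      then show ?thesis by (auto simp: w elim!: evenE)
    qed
    moreover have "dyadic (\<beta> / 2)"
      using dyadic_mult[OF \<beta>(1) dyadic_two_powi[of "-1"]] by (simp add: power_int_def field_simps)
    ultimately have "monom (\<beta> / 2) k \<in> universe poly_model"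
      using \<beta>(3) by (simp add: monom_in_dyadic_polys monom_nonneg)
    moreover have "monom (\<beta> / 2) k * 2 = b"
      by (simp add: b' poly_eq_iff numeral_poly smult_monom)
    ultimately show ?thesis by blast
  qed simp
qed

text \<open>Split \<open>p\<close> as \<open>u * h\<close>, where \<open>u\<close> is a monomial
  \<open>2 powi i * X ^ m\<close> and \<open>h\<close> has an odd integer as constant term. Then
  \<open>h\<close> is a divisor of \<open>p\<close> that is not even, so it must be 1.\<close>

lemma is_pow2_imp_monom:
  assumes p: "p \<in> universe poly_model" and "is_pow2 p"
  shows "\<exists>i m. p = monom (2 powi i) m"
proof -
  have "p \<noteq> 0"
  proof
    \<comment> \<open>Zero is no power of two, since 3 divides it and is neither 1 nor even.\<close>
    assume "p = 0"
    then have "\<exists>c\<in>universe poly_model. c * 3 = p"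
      using dyadic_polys_numerals by (intro bexI[of _ 0]) auto
    then have "(3 :: rat poly) = 1 \<or> (\<exists>c\<in>universe poly_model. c * 2 = (3 :: rat poly))"
      using assms(2) dyadic_polys_numerals(3)[of "num.Bit1 num.One"] unfolding is_pow2_def
      by (meson poly_model_simps(1) zero_le_numeral)
    then obtain c where "c \<in> dyadic_polys" "c * 2 = 3" by auto
    then obtain n where "coeff (3 :: rat poly) 0 = of_int (2 * n)" by (metis coeff_0_double)
    then have "of_int 3 = (of_int (2 * n) :: rat)" by (simp add: numeral_poly)
    then have "3 = 2 * n" by (simp only: of_int_eq_iff)
    then show False by presburger
  qed
  then obtain g where g: "p = monom 1 (order 0 p) * g" "\<not> [:0, 1:] dvd g"
    using order_decomp[of p 0] by (auto simp: monom_altdef)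
  define m where "m = order 0 p"
  have coeff_g: "coeff g j = coeff p (m + j)" for j
    by (subst g(1)) (simp add: coeff_monom_mult m_def)
  have "coeff g 0 \<noteq> 0" using g(2) dvd_iff_poly_eq_0[of 0 g] by (simp add: poly_0_coeff_0)
  moreover have dg: "dyadic (coeff g j)" for j using p by (simp add: coeff_g dyadic_polys_def)
  ultimately obtain i w where w: "coeff g 0 = 2 powi i * of_int w" "odd w"
    using dyadic_decompose by metis
  \<comment> \<open>This is the 2-part of the lowest nonzero term of \<open>p\<close>.\<close>
  define u where "u = monom (2 powi i :: rat) m"
  define h where "h = smult (2 powi (- i)) g"
  have "u = smult (2 powi i) (monom 1 m)" by (simp add: u_def smult_monom)
  then have "u * h = monom 1 m * g" by (simp add: h_def power_int_minus)
  then have uh: "u * h = p" using g(1) by (simp only: m_def)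
  have "u \<in> dyadic_polys"
    unfolding u_def
  proof (rule monom_in_dyadic_polys[OF dyadic_two_powi])
    \<comment> \<open>In this case the lowest term is the constant term of \<open>p\<close>, an
      integer, so its 2-part is one too.\<close>
    assume "m = 0"
    then have "2 powi i * of_int w \<in> (\<int> :: rat set)"
      using p w(1) coeff_g[of 0] by (simp add: dyadic_polys_def)
    then have "i \<ge> 0" using w(2) two_powi_odd_Ints by blast
    then show "2 powi i \<in> (\<int> :: rat set)" by (simp add: power_int_def)
  qed
  moreover have "u \<ge> 0" by (simp add: u_def monom_nonneg)
  ultimately have u: "u \<in> universe poly_model" by simp
  have h0: "coeff h 0 = of_int w" by (simp add: h_def w(1) power_int_minus)
  have "h \<in> dyadic_polys"
    using h0 dg by (auto simp: dyadic_polys_def) (auto simp: h_def intro!: dyadic_mult dyadic_two_powi)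
  moreover have "h \<ge> 0"
  proof -
    have "u \<noteq> 0" by (simp add: u_def)
    then have "u > 0" using \<open>u \<ge> 0\<close> by simp
    moreover have "u * h \<ge> 0" using uh p by simp
    ultimately show ?thesis by (simp add: zero_le_mult_iff)
  qed
  ultimately have "h = 1 \<or> (\<exists>c\<in>universe poly_model. c * 2 = h)"
    using assms(2) u uh by (simp add: is_pow2_def del: poly_model_simps(1)) (metis poly_model_simps(1))
  moreover have "c * 2 \<noteq> h" if "c \<in> universe poly_model" for c
  proof
    assume "c * 2 = h"
    moreover have "c \<in> dyadic_polys" using that by simp
    ultimately obtain n where "coeff h 0 = of_int (2 * n)" by (metis coeff_0_double)
    then have "w = 2 * n" using h0 by (simp only: of_int_eq_iff)
    then show False using w(2) by simp
  qed
  ultimately have "p = monom (2 powi i) m" using uh by (auto simp: u_def)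
  then show ?thesis by blast
qed

text \<open>The order compares degrees first and exponents of 2 next. If \<open>m < n\<close>, the
  exponent \<open>j - i\<close> of the quotient may be negative, which is harmless in positive
  degree.\<close>

lemma is_pow2_dvd:
  assumes "p \<in> universe poly_model" "q \<in> universe poly_model" "is_pow2 p" "is_pow2 q" "p \<le> q"
  shows "\<exists>c\<in>universe poly_model. c * p = q"
proof -
  obtain i m j n where pq: "p = monom (2 powi i) m" "q = monom (2 powi j) n"
    using assms is_pow2_imp_monom by metis
  have "m \<le> n"
  proof (rule ccontr)
    assume "\<not> m \<le> n"
    then have "q < p" unfolding pq
      by (intro poly_less_lead[of _ m]) (auto simp: degree_monom_eq)
    then show False using assms(5) by simp
  qed
  have "m = n \<Longrightarrow> i \<le> j"
    using assms(5) power_int_strict_increasing[of j i "2 :: rat"]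
    by (cases "i \<le> j") (simp_all add: pq monom_mono_iff)
  then have "monom (2 powi (j - i)) (n - m) \<in> dyadic_polys"
    using \<open>m \<le> n\<close> by (intro monom_in_dyadic_polys dyadic_two_powi) (auto simp: power_int_def)
  moreover have "monom (2 powi (j - i)) (n - m) * p = q"
    using \<open>m \<le> n\<close> by (simp add: pq mult_monom flip: power_int_add)
  ultimately show ?thesis by (intro bexI[of _ "monom (2 powi (j - i)) (n - m)"]) (auto simp: monom_nonneg)
qed

text \<open>Start from the power of 2 at or just below the leading coefficient \<open>c\<close>. If
  \<open>c\<close> equals \<open>2 powi i\<close>, negative lower terms can push \<open>p\<close>
  below \<open>2 powi i * X ^ n\<close>, and the exponent \<open>i - 1\<close> is then the right
  one.\<close>

lemma is_pow2_between:
  assumes p: "p \<in> universe poly_model" "p \<noteq> 0"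
  shows "\<exists>u\<in>universe poly_model. is_pow2 u \<and> u \<le> p \<and> p < 2 * u"
proof -
  define n where "n = degree p"
  define c where "c = lead_coeff p"
  have "p > 0" using p by simp
  then have "c > 0" by (simp add: poly_pos_iff c_def)
  moreover have "dyadic c" using p by (simp add: dyadic_polys_def c_def)
  ultimately obtain i where i: "2 powi i \<le> c" "c < 2 powi (i + 1)"
    using dyadic_between_two_powi by metis
  have double: "2 * monom (2 powi j :: rat) n = monom (2 powi (j + 1)) n" for j
    by (simp add: numeral_poly smult_monom power_int_add)
  have "\<exists>j. (n = 0 \<longrightarrow> j \<ge> 0) \<and> monom (2 powi j) n \<le> p \<and> p < monom (2 powi (j + 1)) n"
  proof (cases "monom (2 powi i) n \<le> p")
    case True
    have "p < monom (2 powi (i + 1)) n"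
      using i by (intro poly_less_lead[of _ n]) (auto simp: n_def c_def degree_monom_le)
    \<comment> \<open>A constant \<open>p\<close> must get an integral power of two: it is at least
      1, so \<open>i + 1\<close> is positive.\<close>
    moreover have "i \<ge> 0" if "n = 0"
    proof -
      have "p = monom c 0"
        using that unfolding n_def c_def by (metis degree_eq_zeroE lead_coeff_pCons(2) monom_0)
      moreover have "p \<ge> 1" using p dyadic_polys_ge_1 by simp
      ultimately have "1 \<le> c" using monom_mono_iff[of 1 0 c] by simp
      then have "2 powi 0 < (2 powi (i + 1) :: rat)" using i by simp
      then show "i \<ge> 0" using power_int_increasing[of "i + 1" 0 "2 :: rat"] by force
    qed
    ultimately show ?thesis using True by blast
  next
    case False
    have "n \<noteq> 0"
    proof
      assume "n = 0"
      then have "p = monom c n" unfolding n_def c_def by (metis degree_eq_zeroE lead_coeff_pCons(2) monom_0)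
      then show False using False i by (simp add: monom_mono_iff)
    qed
    have "2 powi (i - 1) < (2 powi i :: rat)" by (intro power_int_strict_increasing) auto
    then have "monom (2 powi (i - 1)) n < p"
      using i by (intro poly_less_lead[of _ n]) (auto simp: n_def c_def degree_monom_le)
    then show ?thesis using False \<open>n \<noteq> 0\<close> by (intro exI[of _ "i - 1"]) auto
  qed
  then obtain j where j: "n = 0 \<Longrightarrow> j \<ge> 0" "monom (2 powi j) n \<le> p" "p < monom (2 powi (j + 1)) n"
    by blast
  have "monom (2 powi j) n \<in> dyadic_polys"
    using j(1) by (intro monom_in_dyadic_polys dyadic_two_powi) (auto simp: power_int_def)
  moreover from this have "is_pow2 (monom (2 powi j) n)" by (rule is_pow2_monom)
  moreover have "0 \<le> monom (2 powi j :: rat) n" by (simp add: monom_nonneg)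
  ultimately show ?thesis using j(2,3) by (intro bexI[of _ "monom (2 powi j) n"]) (simp_all add: double)
qed

section \<open>The axioms of \<open>PA_smu\<close> in the model\<close>

lemma sat_Pow2_poly_model:
  "x < 4 \<Longrightarrow> sat poly_model e (Pow2 (Var x)) \<longleftrightarrow> is_pow2 (e x)"
  by (subst sat_Pow2) (simp_all add: is_pow2_def)

text \<open>Four axioms need the arithmetic of the model: discreteness, subtraction, the largest
  power of two and divisibility of powers of two. They are prepared in the shape to which
  satisfaction unfolds; the others hold in any ordered commutative ring, restricted to nonnegative
  elements.\<close>

lemma poly_model_PA_smu:
  assumes "p \<in> PA_smu"
  shows "true_in poly_model p"
proof -
  have discrete: "y = x \<or> y + 1 \<le> x"
    if "x \<in> dyadic_polys" "y \<in> dyadic_polys" "y \<le> x" for x y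
    using dyadic_polys_ge_1[OF dyadic_polys_diff[OF that(1,2)]] that(3)
    by (cases "y = x") (auto simp: algebra_simps)
  have diff: "\<exists>z. z \<in> dyadic_polys \<and> 0 \<le> z \<and> x = y + z"
    if "x \<in> dyadic_polys" "y \<in> dyadic_polys" "y \<le> x" for x y
    using that by (intro exI[of _ "x - y"]) (simp add: dyadic_polys_diff)
  have msb: "\<exists>u. u \<in> dyadic_polys \<and> 0 \<le> u \<and> is_pow2 u \<and> u \<le> x + 1 \<and> x + 1 \<le> 2 * u \<and> x + 1 \<noteq> 2 * u"
    if "x \<in> dyadic_polys" "0 \<le> x" for x
  proof -
    have "x + 1 \<noteq> 0" using that by (metis add_nonneg_eq_0_iff zero_le_one zero_neq_one)
    moreover have "x + 1 \<in> universe poly_model"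
      using that by (simp add: dyadic_polys_add dyadic_polys_numerals)
    ultimately show ?thesis using is_pow2_between[of "x + 1"] by force
  qed
  have dvd: "\<exists>c. c \<in> dyadic_polys \<and> 0 \<le> c \<and> c * x = y"
    if "is_pow2 x" "is_pow2 y" "x \<le> y" "x \<in> dyadic_polys" "y \<in> dyadic_polys" "0 \<le> x" "0 \<le> y" for x y
    using is_pow2_dvd[of x y] that by auto
  obtain q where q: "p = univ_closure q" "q \<in> {
     vx \<oplus> Zero \<doteq> vx,
     vx \<oplus> vy \<doteq> vy \<oplus> vx,
     (vx \<oplus> vy) \<oplus> vz \<doteq> vx \<oplus> (vy \<oplus> vz),
     vx \<odot> One \<doteq> vx,
     vx \<odot> vy \<doteq> vy \<odot> vx,
     (vx \<odot> vy) \<odot> vz \<doteq> vx \<odot> (vy \<odot> vz),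
     vx \<odot> (vy \<oplus> vz) \<doteq> vx \<odot> vy \<oplus> vx \<odot> vz,
     vx \<preceq> vy \<^bold>\<or> vy \<preceq> vx,
     (vx \<preceq> vy \<^bold>\<and> vy \<preceq> vz) \<^bold>\<longrightarrow> vx \<preceq> vz,
     \<^bold>\<not> (vx \<oplus> One \<preceq> vx),
     vy \<preceq> vx \<^bold>\<longrightarrow> (vy \<doteq> vx \<^bold>\<or> vy \<oplus> One \<preceq> vx),
     vy \<preceq> vx \<^bold>\<longrightarrow> vy \<oplus> vz \<preceq> vx \<oplus> vz,
     vy \<preceq> vx \<^bold>\<longrightarrow> vy \<odot> vz \<preceq> vx \<odot> vz,
     vy \<preceq> vx \<^bold>\<longrightarrow> Exists 2 (vx \<doteq> vy \<oplus> vz),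
     Exists 3 (Pow2 vu \<^bold>\<and> vu \<preceq> vx \<oplus> One \<^bold>\<and> vx \<oplus> One \<prec> Two \<odot> vu),
     (Pow2 vx \<^bold>\<and> Pow2 vy \<^bold>\<and> vx \<preceq> vy) \<^bold>\<longrightarrow> Divides vx vy }"
    using assms unfolding PA_smu_def by (rule imageE)
  have "sat poly_model e q" if "range e \<subseteq> universe poly_model" for e
  proof -
    have "e i \<in> universe poly_model" for i using that by blast
    then have e: "e i \<in> dyadic_polys" "0 \<le> e i" for i by simp_all
    note simps = Less_def sat_Divides sat_Pow2_poly_model Bex_def conj_assoc
    show ?thesis
      using q(2)
      apply (elim insertE emptyE; hypsubst)
                     apply (simp_all add: algebra_simps mult_right_mono linear)[10]
      \<comment> \<open>Here and below, the numbers after \<open>of\<close> are variable indices: 0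
        for \<open>vx\<close> and 1 for \<open>vy\<close>.\<close>
      subgoal using discrete[OF e(1) e(1), of 1 0] by simp
      subgoal by simp
      subgoal using e by (simp add: mult_right_mono)
      subgoal using diff[OF e(1) e(1), of 1 0] by (simp add: simps)
      subgoal using msb[OF e, of 0] by (simp add: simps)
      subgoal using dvd[OF _ _ _ e(1) e(1) e(2) e(2), of 0 1] by (simp add: simps)
      done
  qed
  then have "true_in poly_model q" by (simp add: true_in_def)
  then show ?thesis by (simp add: q(1) true_in_univ_closure)
qed

section \<open>Division by 3 with remainder fails for \<open>X\<close>\<close>

lemma poly_model_X_not_3_mult:
  assumes "a \<in> dyadic_polys" "j = of_int i"
  shows "monom 1 1 \<noteq> 3 * a + j"
proof
  assume "monom 1 1 = 3 * a + j"
  then have "coeff (monom 1 1 :: rat poly) 1 = coeff (3 * a + j) 1" by (rule arg_cong)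
  \<comment> \<open>The constant \<open>j\<close> does not contribute to the coefficient of
    \<open>X\<close>, so 3 would be invertible in Z[1/2].\<close>
  then have "1 = 3 * coeff a 1" by (simp add: assms(2) of_int_poly numeral_poly)
  then have *: "of_int 3 * coeff a 1 = (2 powi 0 :: rat)" by simp
  have "dyadic (coeff a 1)" using assms by (simp add: dyadic_polys_def)
  from odd_dyadic_divisor_two_powi[OF * this] show False by simp
qed

theorem theorem10:
  "\<exists>A :: nat struct. is_model A (PA_smu \<union> Th_univ std_model) \<and>
     (\<exists>d\<in>universe A. \<forall>a\<in>universe A. \<forall>j\<in>{zero_in A, one_in A, add_in A (one_in A) (one_in A)}.
        d \<noteq> add_in A (mul_in A (add_in A (add_in A (one_in A) (one_in A)) (one_in A)) a) j)"
proof -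
  \<comment> \<open>Lists of rationals are countable, and a polynomial is determined by its
    coefficient list.\<close>
  define f :: "rat poly \<Rightarrow> nat" where "f = to_nat \<circ> coeffs"
  define A where "A = image_struct f poly_model"
  have "inj f" unfolding f_def by (intro inj_compose inj_to_nat) (simp add: inj_def coeffs_eq_iff)
  then have inj: "inj_on f (universe poly_model)" by (rule inj_on_subset) simp
  have "is_model poly_model (PA_smu \<union> Th_univ std_model)"
    using is_structure_poly_model poly_model_PA_smu poly_model_Th_univ by (auto simp: is_model_def)
  then have "is_model A (PA_smu \<union> Th_univ std_model)"
    unfolding A_def using inj by (rule is_model_image_struct)
  moreover have "f (monom 1 1) \<in> universe A"
    by (auto simp: A_def intro!: imageI monom_in_dyadic_polys monom_nonneg dyadic_Ints)
  moreover have "f (monom 1 1) \<noteq>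
      add_in A (mul_in A (add_in A (add_in A (one_in A) (one_in A)) (one_in A)) a) j"
    if a: "a \<in> universe A" and j: "j \<in> {zero_in A, one_in A, add_in A (one_in A) (one_in A)}" for a j
  proof -
    note ops = image_struct_ops[OF inj]
    have closed: "p + q \<in> universe poly_model" "p * q \<in> universe poly_model"
      if "p \<in> universe poly_model" "q \<in> universe poly_model" for p q
      using that is_structure_poly_model by (auto simp: is_structure_def)
    have one: "1 \<in> universe poly_model" and zero: "0 \<in> universe poly_model"
      by (simp_all add: dyadic_polys_numerals)
    obtain b where b: "a = f b" "b \<in> universe poly_model" using a by (auto simp: A_def)
    have two: "add_in A (one_in A) (one_in A) = f 2"
      using ops(1)[OF one one] by (simp add: A_def)
    then have three: "add_in A (add_in A (one_in A) (one_in A)) (one_in A) = f 3"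
      using ops(1)[OF closed(1)[OF one one] one] by (simp add: A_def)
    have "j = f 0 \<or> j = f 1 \<or> j = f 2" using j two by (auto simp: A_def)
    \<comment> \<open>The three remainders are treated uniformly as integer constants.\<close>
    then obtain i where i: "j = f (of_int i)" "of_int i \<in> universe poly_model"
      using dyadic_polys_numerals
      by (metis (no_types) of_int_0 of_int_1 of_int_numeral poly_model_simps(1) zero_le_numeral zero one)
    have "3 \<in> universe poly_model" by (simp add: dyadic_polys_numerals)
    then have "add_in A (mul_in A (f 3) a) j = f (3 * b + of_int i)"
      using ops b i closed by (simp add: A_def del: poly_model_simps(1))
    moreover have "monom 1 1 \<noteq> 3 * b + of_int i"
      using poly_model_X_not_3_mult b by simp
    ultimately show ?thesis using \<open>inj f\<close> three by (simp add: inj_eq)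
  qed
  ultimately show ?thesis by blast
qed

end
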